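(* Let $m$ be a positive integer and $x>0$ real. Then $$\frac{\log^m(x)}{m!(-1)^m}=1+\sum_{k=1}^m\sum_{n=1}^\infty(-1)^n\frac{(2n+1)\,\zeta_{n-1}(1_{k-1})\,\zeta^\star_{n+1}(1_{m-k})}{n(n+1)}P_n(2x-1),$$ and for every positive integer $n$, $$\frac{d^n}{dx^n}\left(\log^m(x)\right)=\frac{(-1)^n(n-1)!}{x^n}\sum_{k=1}^m(-1)^k k!\binom{m}{k}\zeta_{n-1}(1_{k-1})\log^{m-k}(x).$$
   Context: $P_n$ denotes the $n$-th Legendre polynomial, $P_n(x)=\frac{1}{2^nn!}\frac{d^n}{dx^n}(x^2-1)^n$. For a composition $\mathbf{k}=(k_1,\dots,k_r)\in\mathbb{N}^r$ and $n\in\mathbb{N}_0$, the multiple harmonic sum and multiple harmonic star sum are $\zeta_n(\mathbf{k})=\sum_{n\ge n_1>\cdots>n_r>0}\prod_j n_j^{-k_j}$ and $\zeta^\star_n(\mathbf{k})=\sum_{n\ge n_1\ge\cdots\ge n_r>0}\prod_j n_j^{-k_j}$, with $\zeta_n(\emptyset)=\zeta^\star_n(\emptyset)=1$ (empty sums are $0$). $1_d$ denotes the string $(1,\dots,1)$ of $d$ ones.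
   Formalization: The Legendre expansion is stated only for 0 < x ≤ 1, because for every x > 1 the values P_n(2x-1) grow exponentially and the series diverges (e.g. m = 1, x = 2); the derivative formula is stated for all x > 0. *)

theory Defs
  imports "HOL-Analysis.Analysis" "HOL-Computational_Algebra.Polynomial"
begin

definition legendre_poly :: "nat \<Rightarrow> real poly" where
  "legendre_poly n = smult (1 / (2 ^ n * fact n)) ((pderiv ^^ n) ([:-1, 0, 1:] ^ n))"

(* A composition (k_1, ..., k_r) is a list of exponents; a summation multi-index
   (n_1, ..., n_r) is a list of the same length.  The index sets are finite, and for
   the empty composition they consist of the empty list alone, giving the value 1. *)

definition mhs :: "nat \<Rightarrow> nat list \<Rightarrow> real" where
  "mhs n ks =
     (\<Sum>ns | length ns = length ks \<and> set ns \<subseteq> {1..n} \<and> sorted_wrt (>) ns.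
        \<Prod>j<length ks. 1 / real (ns ! j) ^ (ks ! j))"

definition mhs_star :: "nat \<Rightarrow> nat list \<Rightarrow> real" where
  "mhs_star n ks =
     (\<Sum>ns | length ns = length ks \<and> set ns \<subseteq> {1..n} \<and> sorted_wrt (\<ge>) ns.
        \<Prod>j<length ks. 1 / real (ns ! j) ^ (ks ! j))"

abbreviation ones :: "nat \<Rightarrow> nat list" where
  "ones d \<equiv> replicate d 1"

definition log_legendre_term :: "nat \<Rightarrow> nat \<Rightarrow> real \<Rightarrow> nat \<Rightarrow> real" where
  "log_legendre_term m k x n =
     (-1) ^ n * (real (2 * n + 1) * mhs (n - 1) (ones (k - 1)) * mhs_star (n + 1) (ones (m - k)))
       / (real n * real (n + 1)) * poly (legendre_poly n) (2 * x - 1)"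

end

(* With (s)_n = s (s + 1) ... (s + n - 1), the Legendre expansion of x powr (-s) on (0, 1] is the sum
   over n of (2 n + 1) (-1)^n (s)_n / (1 - s)_{n+1} P_n (2 x - 1), and the claimed expansion is its
   coefficient of s^m.  The identity
     (2 n + 1) (s)_n / (1 - s)_{n+1} = (s)_{n+1} / (1 - s)_{n+1} + (s)_n / (1 - s)_n
   makes the series telescope at x = 1, and together with the contiguity relation between P_n' and
   P_{n+1}' it shows that the partial sums S_m of the coefficient series satisfy x S_m' = - S_{m-1} up to
   a boundary term, just as f_m = (-ln x)^m / m! satisfies x f_m' = - f_{m-1}.  Induction on m then gives
   uniform convergence on compact subsets of (0, 1], using no more about P_n than its bound by 1 on [-1, 1]. *)

theory Submission
  imports Defs "HOL-Computational_Algebra.Formal_Power_Series"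
begin

subsection \<open>Legendre polynomials\<close>

text \<open>At x = 1 every \<open>P_n\<close> equals 1 and the series is only conditionally
  convergent, so no termwise absolute estimate can reach that endpoint. It serves instead as the
  anchor: the partial sums are known there in closed form, and the error elsewhere is obtained by
  integrating from 1 downwards. The obstacle is the boundary term: it carries (N + 1) times a tail
  coefficient, which does not tend to 0, but it oscillates. An antiderivative of \<open>P_N\<close>
  is of size 1 / N, so the term becomes harmless once integrated. The theorem also asserts
  convergence for each k separately, which does not follow from convergence of the series summed
  over k; this needs its own summation by parts. The derivative formula is independent of the
  expansion. It is an induction on the order of the derivative, in which differentiating the powers
  of the logarithm reproduces the recurrence of the harmonic sums in n.\<close>

lemma pderiv_funpow_smult: "(pderiv ^^ n) (smult c p) = smult c ((pderiv ^^ n) p)"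
  by (induction n) (simp_all add: pderiv_smult)

lemma pderiv_funpow_diff:
  fixes p q :: "'a :: idom poly"
  shows "(pderiv ^^ n) (p - q) = (pderiv ^^ n) p - (pderiv ^^ n) q"
  by (induction n) (simp_all add: pderiv_diff)

text \<open>The Leibniz rule for multiplication by the variable, whose second derivative vanishes,
  so that two terms remain.\<close>

lemma pderiv_funpow_pCons_0:
  fixes p :: "'a :: idom poly"
  shows "(pderiv ^^ Suc n) (pCons 0 p) =
    pCons 0 ((pderiv ^^ Suc n) p) + smult (of_nat (Suc n)) ((pderiv ^^ n) p)"
proof (induction n)
  case 0
  show ?case by (simp add: pderiv_pCons)
next
  case (Suc n)
  have "(pderiv ^^ Suc (Suc n)) (pCons 0 p) = pderiv ((pderiv ^^ Suc n) (pCons 0 p))" by simp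
  also have "\<dots> = pderiv (pCons 0 ((pderiv ^^ Suc n) p) + smult (of_nat (Suc n)) ((pderiv ^^ n) p))"
    by (subst Suc) (rule refl)
  also have "\<dots> = pCons 0 ((pderiv ^^ Suc (Suc n)) p) + smult (of_nat (Suc (Suc n))) ((pderiv ^^ Suc n) p)"
    by (simp add: pderiv_add pderiv_pCons pderiv_smult smult_add_left numeral_poly)
  finally show ?case .
qed

lemma pderiv_quadratic_power:
  "pderiv ([:-1, 0, 1:] ^ Suc n :: real poly) = smult (2 * real (Suc n)) (pCons 0 ([:-1, 0, 1:] ^ n))"
proof -
  have "pderiv [:-1, 0, 1:] = (smult 2 (pCons 0 1) :: real poly)"
    by (simp add: pderiv_pCons one_pCons)
  then show ?thesis
    by (simp add: pderiv_power_Suc del: power_Suc)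
qed

text \<open>In the Rodrigues formula, differentiating \<open>[:-1, 0, 1:] ^ Suc n\<close> once
  produces the factor t, and the Leibniz rule applies to the other derivatives.\<close>

lemma poly_pderiv_legendre_Suc:
  "poly (pderiv (legendre_poly (Suc n))) t =
     t * poly (pderiv (legendre_poly n)) t + real (Suc n) * poly (legendre_poly n) t"
proof -
  define w :: "real poly" where "w = [:-1, 0, 1:] ^ n"
  have "pderiv ((pderiv ^^ Suc n) ([:-1, 0, 1:] ^ Suc n)) = (pderiv ^^ Suc n) (pderiv ([:-1, 0, 1:] ^ Suc n :: real poly))"
    by (metis funpow_swap1)
  also have "\<dots> = smult (2 * real (Suc n)) (pCons 0 ((pderiv ^^ Suc n) w) + smult (real (Suc n)) ((pderiv ^^ n) w))"
    unfolding pderiv_quadratic_power pderiv_funpow_smult pderiv_funpow_pCons_0 w_def by simp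
  finally have "pderiv (legendre_poly (Suc n)) =
      smult (1 / (2 ^ Suc n * fact (Suc n)) * (2 * real (Suc n)))
        (pCons 0 (pderiv ((pderiv ^^ n) w)) + smult (real (Suc n)) ((pderiv ^^ n) w))"
    by (simp add: legendre_poly_def pderiv_smult del: power_Suc)
  also have "1 / (2 ^ Suc n * fact (Suc n)) * (2 * real (Suc n)) = 1 / (2 ^ n * fact n)"
    by (simp add: fact_Suc del: of_nat_Suc)
  finally have eq: "pderiv (legendre_poly (Suc n)) =
      smult (1 / (2 ^ n * fact n))
        (pCons 0 (pderiv ((pderiv ^^ n) w)) + smult (real (Suc n)) ((pderiv ^^ n) w))" .
  show ?thesis
    unfolding eq by (simp add: legendre_poly_def pderiv_smult w_def add_divide_distrib distrib_left)
qed

lemma legendre_poly_0 [simp]: "legendre_poly 0 = 1"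
  by (simp add: legendre_poly_def)

lemma poly_legendre_Suc:
  "real (Suc n) * (poly (legendre_poly (Suc n)) t - t * poly (legendre_poly n) t) =
     (t\<^sup>2 - 1) * poly (pderiv (legendre_poly n)) t"
proof (cases n)
  case 0
  then show ?thesis by (simp add: legendre_poly_def pderiv_pCons)
next
  case (Suc k)
  define w :: "real poly" where "w = [:-1, 0, 1:] ^ n"
  define Y0 Y1 Y2 where "Y0 = poly ((pderiv ^^ k) w) t" and "Y1 = poly ((pderiv ^^ n) w) t"
    and "Y2 = poly ((pderiv ^^ Suc n) w) t"
  define W where "W = poly ((pderiv ^^ Suc n) ([:-1, 0, 1:] ^ Suc n :: real poly)) t"
  have "W = poly ((pderiv ^^ n) (pderiv ([:-1, 0, 1:] ^ Suc n :: real poly))) t"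
    unfolding W_def by (metis funpow_Suc_right o_apply)
  also have "\<dots> = 2 * real (Suc n) * (t * Y1 + real n * Y0)"
    unfolding pderiv_quadratic_power pderiv_funpow_smult Y0_def Y1_def Suc
      pderiv_funpow_pCons_0 by (simp add: w_def Suc)
  finally have W1: "W = 2 * real (Suc n) * (t * Y1 + real n * Y0)" .
  have "[:-1, 0, 1:] ^ Suc n = pCons 0 (pCons 0 w) - w"
    by (simp add: w_def)
  then have "W = poly ((pderiv ^^ Suc n) (pCons 0 (pCons 0 w))) t - Y2"
    by (simp only: W_def pderiv_funpow_diff Y2_def poly_diff)
  also have "poly ((pderiv ^^ Suc n) (pCons 0 (pCons 0 w))) t =
      t * (t * Y2 + real (Suc n) * Y1) + real (Suc n) * (t * Y1 + real n * Y0)"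
    unfolding pderiv_funpow_pCons_0 unfolding Suc pderiv_funpow_pCons_0
    by (simp add: Y0_def Y1_def Y2_def Suc)
  finally have W2: "W = t * (t * Y2 + real (Suc n) * Y1) + real (Suc n) * (t * Y1 + real n * Y0) - Y2" .
  \<comment> \<open>\<open>Y0\<close> is a derivative of too low an order to be expressed by
    \<open>P_n\<close> or its derivative. Writing \<open>W\<close> as twice \<open>W2\<close> minus
    \<open>W1\<close> eliminates it.\<close>
  have W3: "W = 2 * (real (Suc n) * t * Y1) + 2 * (t\<^sup>2 - 1) * Y2"
    using W1 W2 by (simp add: algebra_simps power2_eq_square)
  define c :: real where "c = 2 ^ n * fact n"
  have c0: "c \<noteq> 0" by (simp add: c_def)
  have P: "poly (legendre_poly (Suc n)) t = W / (2 * real (Suc n) * c)"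
    "poly (legendre_poly n) t = Y1 / c" "poly (pderiv (legendre_poly n)) t = Y2 / c"
    by (simp_all add: legendre_poly_def W_def Y1_def Y2_def w_def c_def pderiv_smult
      power_Suc[of "2::real"] algebra_simps del: power_Suc of_nat_Suc)
  have "real (Suc n) * (W / (2 * real (Suc n) * c) - t * (Y1 / c)) = (W - 2 * (real (Suc n) * t * Y1)) / (2 * c)"
    using c0 by (simp add: field_simps del: of_nat_Suc)
  also have "\<dots> = (t\<^sup>2 - 1) * (Y2 / c)"
    using c0 by (simp add: W3 divide_simps)
  finally show ?thesis by (simp only: P)
qed

lemma poly_legendre_1 [simp]: "poly (legendre_poly n) 1 = 1"
proof (induction n)
  case (Suc n)
  then show ?case using poly_legendre_Suc[of n 1] by simp
qed simp

lemma poly_legendre_minus_1: "poly (legendre_poly n) (-1) = (-1) ^ n"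
proof (induction n)
  case (Suc n)
  then show ?case using poly_legendre_Suc[of n "-1"] by (simp add: add_eq_0_iff)
qed simp

lemma poly_legendre_Suc_pderiv:
  "t * poly (pderiv (legendre_poly (Suc n))) t - poly (pderiv (legendre_poly n)) t =
     real (Suc n) * poly (legendre_poly (Suc n)) t"
proof -
  have "t * poly (pderiv (legendre_poly (Suc n))) t - poly (pderiv (legendre_poly n)) t =
      (t\<^sup>2 - 1) * poly (pderiv (legendre_poly n)) t + real (Suc n) * t * poly (legendre_poly n) t"
    by (simp add: poly_pderiv_legendre_Suc algebra_simps power2_eq_square)
  then show ?thesis
    using poly_legendre_Suc[of n t] by (simp add: algebra_simps)
qed

text \<open>The sum of the two relations used. With t = 2 x - 1 the factor 1 + t becomes 2 x, which
  is what matches the operator x d/dx.\<close>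

lemma poly_pderiv_legendre_diff:
  "(1 + t) * (poly (pderiv (legendre_poly (Suc n))) t - poly (pderiv (legendre_poly n)) t) =
     real (Suc n) * (poly (legendre_poly (Suc n)) t + poly (legendre_poly n) t)"
  using poly_legendre_Suc_pderiv[of t n] poly_pderiv_legendre_Suc[of n t]
  by (simp add: algebra_simps)

text \<open>The two relations at adjacent indices share the term \<open>t * P_(n+1)'\<close>, which
  cancels. The result supplies an explicit antiderivative of a Legendre polynomial.\<close>

lemma poly_pderiv_legendre_diff2:
  "poly (pderiv (legendre_poly (Suc (Suc n)))) t - poly (pderiv (legendre_poly n)) t =
     real (2 * n + 3) * poly (legendre_poly (Suc n)) t"
  using poly_legendre_Suc_pderiv[of t n] poly_pderiv_legendre_Suc[of "Suc n" t]
  by (simp add: algebra_simps)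

lemma legendre_recurrence:
  "real (n + 2) * poly (legendre_poly (Suc (Suc n))) t =
     real (2 * n + 3) * t * poly (legendre_poly (Suc n)) t - real (Suc n) * poly (legendre_poly n) t"
proof -
  have "(t\<^sup>2 - 1) * poly (pderiv (legendre_poly (Suc n))) t =
      t * ((t\<^sup>2 - 1) * poly (pderiv (legendre_poly n)) t)
        + real (Suc n) * (t\<^sup>2 - 1) * poly (legendre_poly n) t"
    by (simp add: poly_pderiv_legendre_Suc algebra_simps)
  then show ?thesis
    unfolding poly_legendre_Suc[symmetric] by (simp add: algebra_simps power2_eq_square)
qed

text \<open>The Christoffel-Darboux formula with second argument -1, where \<open>P_n\<close> takes
  the value \<open>(-1) ^ n\<close>; the induction step is the three-term recurrence.\<close>

lemma legendre_christoffel_darboux_minus_1: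
  "(1 + t) * (\<Sum>n\<le>N. (-1) ^ n * real (2 * n + 1) * poly (legendre_poly n) t) =
     (-1) ^ N * real (Suc N) * (poly (legendre_poly (Suc N)) t + poly (legendre_poly N) t)"
proof (induction N)
  case 0
  then show ?case using legendre_poly_def[of 1] by (simp add: pderiv_pCons)
next
  case (Suc N)
  have "(1 + t) * (\<Sum>n\<le>Suc N. (-1) ^ n * real (2 * n + 1) * poly (legendre_poly n) t) =
      (-1) ^ N * real (Suc N) * (poly (legendre_poly (Suc N)) t + poly (legendre_poly N) t)
       - (-1) ^ N * (real (2 * N + 3) * t * poly (legendre_poly (Suc N)) t
          + real (2 * N + 3) * poly (legendre_poly (Suc N)) t)"
    using Suc by (simp add: algebra_simps)
  also have "real (2 * N + 3) * t * poly (legendre_poly (Suc N)) t =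
      real (N + 2) * poly (legendre_poly (Suc (Suc N))) t + real (Suc N) * poly (legendre_poly N) t"
    using legendre_recurrence[of N t] by simp
  finally show ?case by (simp add: algebra_simps)
qed

lemma legendre_ode:
  "(1 - t\<^sup>2) * poly (pderiv (pderiv (legendre_poly n))) t =
     2 * t * poly (pderiv (legendre_poly n)) t - real n * real (Suc n) * poly (legendre_poly n) t"
proof -
  define p where "p = legendre_poly n"
  define r where "r = legendre_poly (Suc n)"
  \<comment> \<open>The pointwise relation is lifted to an identity of polynomials so that it can be
    differentiated; \<open>P_(n+1)'\<close> is then eliminated.\<close>
  have eq: "smult (real (Suc n)) (r - pCons 0 p) = [:-1, 0, 1:] * pderiv p"
    by (rule poly_ext)
       (use poly_legendre_Suc[of n] in \<open>simp add: p_def r_def algebra_simps power2_eq_square\<close>)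
  have "poly (pderiv (smult (real (Suc n)) (r - pCons 0 p))) t =
      poly (pderiv ([:-1, 0, 1:] * pderiv p)) t"
    by (simp only: eq)
  then have "real (Suc n) * (poly (pderiv r) t - poly p t - t * poly (pderiv p) t) =
      2 * t * poly (pderiv p) t - (1 - t\<^sup>2) * poly (pderiv (pderiv p)) t"
    by (simp add: pderiv_smult pderiv_diff pderiv_pCons pderiv_mult algebra_simps power2_eq_square)
  moreover have "poly (pderiv r) t = t * poly (pderiv p) t + real (Suc n) * poly p t"
    by (simp add: p_def r_def poly_pderiv_legendre_Suc)
  ultimately show ?thesis by (simp add: p_def algebra_simps)
qed

text \<open>By the differential equation, the energy \<open>n (n + 1) P\<^sub>n\<^sup>2 + (1 - t\<^sup>2) P\<^sub>n'\<^sup>2\<close> has derivative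
  \<open>2 t P\<^sub>n'\<^sup>2\<close>, so on \<open>[-1, 1]\<close> it is largest at the endpoints.\<close>
lemma abs_legendre_le_1:
  assumes "\<bar>t\<bar> \<le> 1"
  shows "\<bar>poly (legendre_poly n) t\<bar> \<le> 1"
proof (cases "n = 0")
  case False
  define p where "p = legendre_poly n"
  define h where "h = (\<lambda>t. real n * real (Suc n) * (poly p t)\<^sup>2 + (1 - t\<^sup>2) * (poly (pderiv p) t)\<^sup>2)"
  have h': "(h has_real_derivative 2 * t * (poly (pderiv p) t)\<^sup>2) (at t)" for t
  proof -
    have "(h has_real_derivative real n * real (Suc n) * (2 * poly p t * poly (pderiv p) t) +
       ((- 2 * t) * (poly (pderiv p) t)\<^sup>2 +
         (1 - t\<^sup>2) * (2 * poly (pderiv p) t * poly (pderiv (pderiv p)) t))) (at t)"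
      unfolding h_def by (auto intro!: derivative_eq_intros simp: power2_eq_square algebra_simps)
    also have "real n * real (Suc n) * (2 * poly p t * poly (pderiv p) t) +
       ((- 2 * t) * (poly (pderiv p) t)\<^sup>2 +
         (1 - t\<^sup>2) * (2 * poly (pderiv p) t * poly (pderiv (pderiv p)) t)) =
       2 * poly (pderiv p) t * ((1 - t\<^sup>2) * poly (pderiv (pderiv p)) t + real n * real (Suc n) * poly p t
         - t * poly (pderiv p) t)"
      by (simp add: algebra_simps power2_eq_square)
    also have "\<dots> = 2 * t * (poly (pderiv p) t)\<^sup>2"
      unfolding p_def legendre_ode by (simp add: algebra_simps power2_eq_square)
    finally show ?thesis .
  qed
  have end_h: "h 1 = real n * real (Suc n)" "h (-1) = real n * real (Suc n)"
    by (simp_all add: h_def p_def poly_legendre_minus_1 flip: power_mult)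
  have "h t \<le> real n * real (Suc n)"
  proof (cases "t \<ge> 0")
    case True
    have "h t \<le> h 1"
      by (rule DERIV_nonneg_imp_nondecreasing[of t 1]) (use True assms h' in force)+
    then show ?thesis using end_h by simp
  next
    case False
    have "h t \<le> h (-1)"
    proof (rule DERIV_nonpos_imp_nonincreasing[of "-1" t])
      fix x assume "-1 \<le> x" "x \<le> t"
      with False have "2 * x * (poly (pderiv p) x)\<^sup>2 \<le> 0"
        using mult_nonpos_nonneg[of "2 * x" "(poly (pderiv p) x)\<^sup>2"] by simp
      then show "\<exists>y. (h has_real_derivative y) (at x) \<and> y \<le> 0" using h' by blast
    qed (use assms in auto)
    then show ?thesis using end_h by simp
  qed
  moreover have "(1 - t\<^sup>2) * (poly (pderiv p) t)\<^sup>2 \<ge> 0"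
    using assms by (intro mult_nonneg_nonneg) (auto simp: abs_square_le_1)
  ultimately have "real n * real (Suc n) * (poly p t)\<^sup>2 \<le> real n * real (Suc n) * 1"
    by (simp add: h_def)
  with False have "(poly p t)\<^sup>2 \<le> 1"
    by (subst (asm) mult_le_cancel_left_pos) auto
  then show ?thesis by (simp add: p_def abs_square_le_1)
qed simp

subsection \<open>Multiple harmonic sums over strings of ones\<close>

definition mhs1 :: "nat \<Rightarrow> nat \<Rightarrow> real" where
  "mhs1 n d = mhs n (ones d)"

definition mhs_star1 :: "nat \<Rightarrow> nat \<Rightarrow> real" where
  "mhs_star1 n d = mhs_star n (ones d)"

lemma prod_ones:
  "length ns = d \<Longrightarrow> (\<Prod>j<d. 1 / real (ns ! j) ^ (ones d ! j)) = prod_list (map (\<lambda>i. 1 / real i) ns)"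
  by (auto simp: prod.list_conv_set_nth atLeast0LessThan intro!: prod.cong)

definition dec_lists :: "(nat \<Rightarrow> nat \<Rightarrow> bool) \<Rightarrow> nat \<Rightarrow> nat \<Rightarrow> nat list set" where
  "dec_lists R n d = {ns. length ns = d \<and> set ns \<subseteq> {1..n} \<and> sorted_wrt R ns}"

lemma finite_dec_lists: "finite (dec_lists R n d)"
  unfolding dec_lists_def
  by (rule finite_subset[OF _ finite_lists_length_eq[of "{1..n}" d]]) auto

lemma mhs1_eq: "mhs1 n d = (\<Sum>ns\<in>dec_lists (>) n d. prod_list (map (\<lambda>i. 1 / real i) ns))"
  unfolding mhs1_def mhs_def dec_lists_def length_replicate by (intro sum.cong refl prod_ones) simp

lemma mhs_star1_eq: "mhs_star1 n d = (\<Sum>ns\<in>dec_lists (\<ge>) n d. prod_list (map (\<lambda>i. 1 / real i) ns))"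
  unfolding mhs_star1_def mhs_star_def dec_lists_def length_replicate by (intro sum.cong refl prod_ones) simp

lemma dec_lists_0: "dec_lists R n 0 = {[]}"
  by (auto simp: dec_lists_def)

lemma dec_lists_0_Suc: "dec_lists R 0 (Suc d) = {}"
  by (auto simp: dec_lists_def)

text \<open>Split by whether the head, which is the largest entry, equals \<open>Suc n\<close>.
  Strict decrease then confines the tail to \<open>{1..n}\<close>.\<close>

lemma dec_lists_gt_Suc_Suc:
  "dec_lists (>) (Suc n) (Suc d) = dec_lists (>) n (Suc d) \<union> (#) (Suc n) ` dec_lists (>) n d"
proof (intro equalityI subsetI)
  fix ns assume ns: "ns \<in> dec_lists (>) (Suc n) (Suc d)"
  then obtain a as where as: "ns = a # as" by (cases ns) (auto simp: dec_lists_def)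
  show "ns \<in> dec_lists (>) n (Suc d) \<union> (#) (Suc n) ` dec_lists (>) n d"
  proof (cases "a = Suc n")
    case True
    with ns show ?thesis by (force simp: as dec_lists_def)
  next
    case False
    with ns show ?thesis by (fastforce simp: as dec_lists_def)
  qed
qed (fastforce simp: dec_lists_def)

text \<open>Here \<open>Suc n\<close> may be repeated, so the tail keeps the upper limit
  \<open>Suc n\<close>. This is the only difference between the recurrences of the two kinds of
  sum.\<close>

lemma dec_lists_ge_Suc_Suc:
  "dec_lists (\<ge>) (Suc n) (Suc d) = dec_lists (\<ge>) n (Suc d) \<union> (#) (Suc n) ` dec_lists (\<ge>) (Suc n) d"
proof (intro equalityI subsetI)
  fix ns assume ns: "ns \<in> dec_lists (\<ge>) (Suc n) (Suc d)"
  then obtain a as where as: "ns = a # as" by (cases ns) (auto simp: dec_lists_def)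
  show "ns \<in> dec_lists (\<ge>) n (Suc d) \<union> (#) (Suc n) ` dec_lists (\<ge>) (Suc n) d"
  proof (cases "a = Suc n")
    case True
    with ns show ?thesis by (force simp: as dec_lists_def)
  next
    case False
    with ns show ?thesis by (fastforce simp: as dec_lists_def)
  qed
qed (fastforce simp: dec_lists_def)

lemma disjoint_dec_lists: "dec_lists R n (Suc d) \<inter> (#) (Suc n) ` S = {}"
  by (auto simp: dec_lists_def)

lemma mhs1_0 [simp]: "mhs1 n 0 = 1" "mhs1 0 (Suc d) = 0"
  by (simp_all add: mhs1_eq dec_lists_0 dec_lists_0_Suc)

lemma mhs_star1_0 [simp]: "mhs_star1 n 0 = 1" "mhs_star1 0 (Suc d) = 0"
  by (simp_all add: mhs_star1_eq dec_lists_0 dec_lists_0_Suc)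

lemma mhs1_Suc_Suc: "mhs1 (Suc n) (Suc d) = mhs1 n (Suc d) + mhs1 n d / real (Suc n)"
  unfolding mhs1_eq dec_lists_gt_Suc_Suc
  by (subst sum.union_disjoint)
     (simp_all add: finite_dec_lists disjoint_dec_lists sum.reindex sum_divide_distrib)

lemma mhs_star1_Suc_Suc:
  "mhs_star1 (Suc n) (Suc d) = mhs_star1 n (Suc d) + mhs_star1 (Suc n) d / real (Suc n)"
  unfolding mhs_star1_eq dec_lists_ge_Suc_Suc
  by (subst sum.union_disjoint)
     (simp_all add: finite_dec_lists disjoint_dec_lists sum.reindex sum_divide_distrib)

section \<open>Positivity, monotonicity and logarithmic growth of the sums\<close>

lemma mhs1_nonneg: "mhs1 n d \<ge> 0" and mhs_star1_nonneg: "mhs_star1 n d \<ge> 0"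
  unfolding mhs1_def mhs_def mhs_star1_def mhs_star_def by (auto intro!: sum_nonneg prod_nonneg)

lemma mhs1_le_Suc: "mhs1 n d \<le> mhs1 (Suc n) d"
  by (cases d) (simp_all add: mhs1_Suc_Suc mhs1_nonneg)

lemma mhs_star1_le_Suc: "mhs_star1 n d \<le> mhs_star1 (Suc n) d"
  by (cases d) (simp_all add: mhs_star1_Suc_Suc mhs_star1_nonneg)

lemma mhs1_le_harm: "mhs1 n d \<le> harm n ^ d"
proof (induction n arbitrary: d)
  case 0
  then show ?case by (cases d) (simp_all add: harm_expand)
next
  case (Suc n)
  show ?case
  proof (cases d)
    case (Suc d')
    have "mhs1 (Suc n) d \<le> harm n ^ d' * harm n + harm n ^ d' / real (Suc n)"
      unfolding Suc mhs1_Suc_Suc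
      using Suc.IH[of "Suc d'"] Suc.IH[of d'] by (intro add_mono divide_right_mono) (auto simp: mult.commute)
    also have "\<dots> = harm n ^ d' * harm (Suc n)"
      by (simp add: harm_Suc field_simps)
    also have "\<dots> \<le> harm (Suc n) ^ d' * harm (Suc n)"
      by (intro mult_right_mono power_mono harm_mono harm_nonneg) auto
    finally show ?thesis by (simp add: Suc mult.commute)
  qed simp
qed

text \<open>The recurrence lowers either n or d but not always n, hence an induction on n nested in
  one on d; for \<open>mhs1\<close> induction on n alone suffices.\<close>

lemma mhs_star1_le_harm: "mhs_star1 n d \<le> harm n ^ d"
proof (induction d arbitrary: n)
  case (Suc d)
  note IH = Suc.IH
  show ?case
  proof (induction n)
    case (Suc n)
    have "mhs_star1 (Suc n) (Suc d) \<le> harm n ^ d * harm n + harm (Suc n) ^ d / real (Suc n)"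
      unfolding mhs_star1_Suc_Suc
      using Suc.IH IH[of "Suc n"] by (intro add_mono divide_right_mono) (auto simp: mult.commute)
    also have "\<dots> \<le> harm (Suc n) ^ d * harm n + harm (Suc n) ^ d / real (Suc n)"
      by (intro add_mono mult_right_mono power_mono harm_mono harm_nonneg) auto
    also have "\<dots> = harm (Suc n) ^ Suc d"
      by (simp add: harm_Suc[of n] distrib_left distrib_right inverse_eq_divide)
    finally show ?case .
  qed (simp add: harm_expand)
qed simp

subsection \<open>Generating functions of the coefficients\<close>

text \<open>The sums over ones are the elementary symmetric (\<open>mhs1\<close>) and complete
  homogeneous (\<open>mhs_star1\<close>) polynomials in 1, 1/2, ..., 1/n. Their generating functions
  are therefore the products over j from 1 to n of 1 + s/j and of 1/(1 - s/j), with
  \<open>fps_X\<close> as s.\<close>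

definition mhs_fps :: "nat \<Rightarrow> real fps" where
  "mhs_fps n = Abs_fps (mhs1 n)"

definition mhs_star_fps :: "nat \<Rightarrow> real fps" where
  "mhs_star_fps n = Abs_fps (mhs_star1 n)"

lemma mhs_fps_Suc:
  "(fps_X + fps_const (real (Suc n))) * mhs_fps n = fps_const (real (Suc n)) * mhs_fps (Suc n)"
proof (rule fps_ext)
  fix d
  show "fps_nth ((fps_X + fps_const (real (Suc n))) * mhs_fps n) d =
      fps_nth (fps_const (real (Suc n)) * mhs_fps (Suc n)) d"
    by (cases d) (simp_all add: mhs_fps_def mhs1_Suc_Suc distrib_left distrib_right del: of_nat_Suc)
qed

lemma mhs_star_fps_Suc:
  "(fps_const (real (Suc n)) - fps_X) * mhs_star_fps (Suc n) = fps_const (real (Suc n)) * mhs_star_fps n"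
proof (rule fps_ext)
  fix d
  show "fps_nth ((fps_const (real (Suc n)) - fps_X) * mhs_star_fps (Suc n)) d =
      fps_nth (fps_const (real (Suc n)) * mhs_star_fps n) d"
    by (cases d) (simp_all add: mhs_star_fps_def mhs_star1_Suc_Suc distrib_left left_diff_distrib del: of_nat_Suc)
qed

lemma mhs_fps_0: "mhs_fps 0 = 1"
proof -
  have "mhs1 0 d = (if d = 0 then 1 else 0)" for d
    by (cases d) simp_all
  then show ?thesis by (simp add: mhs_fps_def fps_eq_iff)
qed

text \<open>\<open>log_fps n\<close> is \<open>(s)\<^sub>n / (1 - s)\<^sub>n\<^sub>+\<^sub>1\<close> expanded in powers of \<open>s\<close>, that is, up to the
  sign \<open>(-1)\<^sup>n\<close>, the integral of \<open>x powr (-s) * P\<^sub>n (2 * x - 1)\<close> over \<open>[0, 1]\<close>.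
  \<open>tail_fps n\<close> is \<open>(s)\<^sub>n\<^sub>+\<^sub>1 / (1 - s)\<^sub>n\<^sub>+\<^sub>1\<close>.\<close>

definition tail_fps :: "nat \<Rightarrow> real fps" where
  "tail_fps n = fps_const (1 / real (Suc n)) * (fps_X * (mhs_fps n * mhs_star_fps (Suc n)))"

definition log_fps :: "nat \<Rightarrow> real fps" where
  "log_fps n = (if n = 0 then mhs_star_fps 1 else
     fps_const (1 / (real n * real (Suc n))) * (fps_X * (mhs_fps (n - 1) * mhs_star_fps (Suc n))))"

text \<open>The factor s + n extends the numerator \<open>(s)_n\<close> to
  \<open>(s)_(n+1)\<close>.\<close>

lemma log_fps_up: "(fps_X + fps_const (real n)) * log_fps n = tail_fps n"
proof (cases n)
  case (Suc k)
  have "(fps_X + fps_const (real n)) * log_fps n =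
      fps_const (1 / (real n * real (Suc n))) * fps_X * mhs_star_fps (Suc n) *
        ((fps_X + fps_const (real (Suc k))) * mhs_fps k)"
    by (simp add: log_fps_def Suc del: of_nat_Suc)
  also have "\<dots> = (fps_const (1 / (real n * real (Suc n))) * fps_const (real n)) *
      (fps_X * (mhs_fps n * mhs_star_fps (Suc n)))"
    unfolding mhs_fps_Suc by (simp add: Suc mult.assoc mult.left_commute mult.commute del: of_nat_Suc fps_const_mult)
  also have "\<dots> = tail_fps n"
    by (simp add: tail_fps_def Suc)
  finally show ?thesis .
qed (simp add: log_fps_def tail_fps_def mhs_fps_0)

text \<open>The factor n + 2 - s is the last one of the denominator \<open>(1 - s)_(n+2)\<close> and
  cancels it.\<close>

lemma log_fps_down: "(fps_const (real (Suc (Suc n))) - fps_X) * log_fps (Suc n) = tail_fps n"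
proof -
  have "(fps_const (real (Suc (Suc n))) - fps_X) * log_fps (Suc n) =
      fps_const (1 / (real (Suc n) * real (Suc (Suc n)))) * fps_X * mhs_fps n *
        ((fps_const (real (Suc (Suc n))) - fps_X) * mhs_star_fps (Suc (Suc n)))"
    by (simp add: log_fps_def del: of_nat_Suc)
  also have "\<dots> = (fps_const (1 / (real (Suc n) * real (Suc (Suc n)))) * fps_const (real (Suc (Suc n)))) *
      (fps_X * (mhs_fps n * mhs_star_fps (Suc n)))"
    unfolding mhs_star_fps_Suc by (simp add: mult.assoc mult.left_commute mult.commute del: of_nat_Suc fps_const_mult)
  also have "\<dots> = tail_fps n"
    by (simp add: tail_fps_def del: of_nat_Suc)
  finally show ?thesis .
qed

section \<open>Coefficients of s^m: recurrences and decay\<close>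

definition log_coeff :: "nat \<Rightarrow> nat \<Rightarrow> real" where
  "log_coeff m n = fps_nth (log_fps n) m"

definition tail_coeff :: "nat \<Rightarrow> nat \<Rightarrow> real" where
  "tail_coeff m n = fps_nth (tail_fps n) m"

lemma tail_coeff_0 [simp]: "tail_coeff 0 n = 0"
  by (simp add: tail_coeff_def tail_fps_def)

text \<open>For n = 0 the generating function is 1/(1 - s). This is the origin of the isolated
  summand 1 in the expansion.\<close>

lemma log_coeff_at_0 [simp]: "log_coeff m 0 = 1"
proof -
  have "mhs_star1 (Suc 0) m = 1" by (induction m) (simp_all add: mhs_star1_Suc_Suc)
  then show ?thesis by (simp add: log_coeff_def log_fps_def mhs_star_fps_def)
qed

lemma log_coeff_0_Suc [simp]: "log_coeff 0 (Suc n) = 0"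
  by (simp add: log_coeff_def log_fps_def)

lemma log_coeff_up: "log_coeff m n + real n * log_coeff (Suc m) n = tail_coeff (Suc m) n"
  unfolding log_coeff_def tail_coeff_def log_fps_up[symmetric] by (simp add: distrib_right)

lemma log_coeff_down:
  "real (Suc (Suc n)) * log_coeff (Suc m) (Suc n) - log_coeff m (Suc n) = tail_coeff (Suc m) n"
  unfolding log_coeff_def tail_coeff_def log_fps_down[symmetric]
  by (simp add: left_diff_distrib del: of_nat_Suc)

text \<open>Adding the upward and downward relations, the factors s + (n + 1) and (n + 2) - s sum to
  2 n + 3, so no shift in m remains.\<close>

lemma tail_coeff_add:
  "tail_coeff m (Suc n) + tail_coeff m n = real (2 * n + 3) * log_coeff m (Suc n)"
proof (cases m)
  case (Suc k)
  show ?thesis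
    using log_coeff_up[of k "Suc n"] log_coeff_down[of n k] unfolding Suc by (simp add: algebra_simps)
qed simp

text \<open>The weights n + 2 and n + 1 are chosen to cancel
  \<open>log_coeff (Suc m) (Suc n)\<close>, leaving only coefficients of order m.\<close>

lemma tail_coeff_diff:
  "real (Suc (Suc n)) * tail_coeff (Suc m) (Suc n) - real (Suc n) * tail_coeff (Suc m) n =
     real (2 * n + 3) * log_coeff m (Suc n)"
proof -
  have up: "tail_coeff (Suc m) (Suc n) = log_coeff m (Suc n) + real (Suc n) * log_coeff (Suc m) (Suc n)"
    using log_coeff_up[of m "Suc n"] by simp
  have down: "tail_coeff (Suc m) n = real (Suc (Suc n)) * log_coeff (Suc m) (Suc n) - log_coeff m (Suc n)"
    using log_coeff_down[of n m] by simp
  show ?thesis unfolding up down by (simp add: algebra_simps)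
qed

lemma tail_coeff_at_0: "tail_coeff (Suc m) 0 = 1"
  using log_coeff_up[of m 0] by simp

lemma tail_coeff_Suc_eq:
  "tail_coeff (Suc m) n = (\<Sum>k\<le>m. mhs1 n k * mhs_star1 (Suc n) (m - k)) / real (Suc n)"
  by (simp add: tail_coeff_def tail_fps_def del: of_nat_Suc)
     (simp add: fps_mult_nth mhs_fps_def mhs_star_fps_def atLeast0AtMost)

lemma log_coeff_Suc_Suc_eq:
  "log_coeff (Suc m) (Suc n) =
     (\<Sum>k\<le>m. mhs1 n k * mhs_star1 (n + 2) (m - k)) / (real (Suc n) * real (n + 2))"
  by (simp add: log_coeff_def log_fps_def del: of_nat_Suc)
     (simp add: fps_mult_nth mhs_fps_def mhs_star_fps_def atLeast0AtMost)

lemma tail_coeff_nonneg: "tail_coeff m n \<ge> 0"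
  by (cases m) (auto simp: tail_coeff_Suc_eq mhs1_nonneg mhs_star1_nonneg
    intro!: sum_nonneg divide_nonneg_nonneg mult_nonneg_nonneg)

text \<open>The exponent 1 / (2 (p + 1)) makes the (p + 1)-st power of the quotient have denominator
  \<open>sqrt (real n)\<close>. Using p + 1 instead of p covers p = 0, and costs nothing since
  \<open>harm (Suc n)\<close> is at least 1.\<close>

lemma harm_power_sqrt_tendsto_0: "(\<lambda>n. harm (Suc n) ^ p / sqrt (real n)) \<longlonglongrightarrow> (0 :: real)"
proof (rule tendsto_sandwich[where f = "\<lambda>_. 0" and h = "\<lambda>n. (harm (Suc n) / real n powr (1 / (2 * real (Suc p)))) ^ Suc p"])
  define s :: real where "s = 1 / (2 * real (Suc p))"
  have s: "s > 0" by (simp add: s_def)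
  \<comment> \<open>\<open>harm (Suc n)\<close> is split as (harm n - ln n) + ln n + 1/(n + 1): a
    convergent part, a logarithm and a null sequence.\<close>
  have "(\<lambda>n. (harm n - ln (real n)) * (1 / real n powr s) + ln (real n) / real n powr s
      + inverse (real (Suc n)) * (1 / real n powr s)) \<longlonglongrightarrow> euler_mascheroni * 0 + 0 + 0 * (0 :: real)"
    by (intro tendsto_intros euler_mascheroni_LIMSEQ lim_ln_over_power s LIMSEQ_inverse_real_of_nat
      lim_1_over_real_power)
  also have "(\<lambda>n. (harm n - ln (real n)) * (1 / real n powr s) + ln (real n) / real n powr s
      + inverse (real (Suc n)) * (1 / real n powr s)) = (\<lambda>n. harm (Suc n) / real n powr s)"
    by (simp add: fun_eq_iff harm_Suc divide_inverse algebra_simps)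
  finally have "(\<lambda>n. harm (Suc n) / real n powr s) \<longlonglongrightarrow> 0" by simp
  from tendsto_power[OF this, of "Suc p"]
  show "(\<lambda>n. (harm (Suc n) / real n powr (1 / (2 * real (Suc p)))) ^ Suc p) \<longlonglongrightarrow> (0 :: real)"
    by (simp add: s_def del: of_nat_Suc)
  show "eventually (\<lambda>n. harm (Suc n) ^ p / sqrt (real n) \<le>
      (harm (Suc n) / real n powr (1 / (2 * real (Suc p)))) ^ Suc p) sequentially"
    using eventually_gt_at_top[of 0]
  proof eventually_elim
    case (elim n)
    have "(real n powr s) ^ Suc p = real n powr (s * real (Suc p))"
      using elim by (subst powr_realpow[symmetric]) (simp_all add: powr_powr)
    also have "s * real (Suc p) = 1 / 2" unfolding s_def by (simp del: of_nat_Suc)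
    finally have eq: "(real n powr s) ^ Suc p = sqrt (real n)" by (simp add: powr_half_sqrt)
    have "harm (Suc 0) \<le> (harm (Suc n) :: real)" by (rule harm_mono) simp
    then have "(harm (Suc n) :: real) ^ p \<le> harm (Suc n) ^ Suc p"
      by (intro power_increasing) (simp_all add: harm_expand)
    then show ?case unfolding s_def[symmetric] power_divide eq by (rule divide_right_mono) simp
  qed
  show "eventually (\<lambda>n. 0 \<le> harm (Suc n) ^ p / sqrt (real n)) sequentially"
    by (simp add: harm_nonneg)
qed simp

lemma mhs1_mult_mhs_star1_le:
  assumes "n \<le> n'"
  shows "mhs1 n k * mhs_star1 n' l \<le> harm n' ^ (k + l)"
proof -
  have "mhs1 n k * mhs_star1 n' l \<le> harm n ^ k * harm n' ^ l"
    by (intro mult_mono mhs1_le_harm mhs_star1_le_harm mhs_star1_nonneg zero_le_power harm_nonneg)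
  also have "\<dots> \<le> harm n' ^ k * harm n' ^ l"
    by (intro mult_right_mono power_mono harm_mono assms zero_le_power harm_nonneg)
  finally show ?thesis by (simp add: power_add)
qed

lemma tail_coeff_tendsto_0: "tail_coeff m \<longlonglongrightarrow> 0"
proof (cases m)
  case (Suc p)
  show ?thesis
  proof (rule tendsto_sandwich)
    show "eventually (\<lambda>n. tail_coeff m n \<ge> 0) sequentially"
      by (simp add: tail_coeff_nonneg)
    show "eventually (\<lambda>n. tail_coeff m n \<le> real (Suc p) * (harm (Suc n) ^ p / sqrt (real n))) sequentially"
      using eventually_gt_at_top[of 0]
    proof eventually_elim
      case (elim n)
      have "(\<Sum>k\<le>p. mhs1 n k * mhs_star1 (Suc n) (p - k)) \<le> (\<Sum>k\<le>p. harm (Suc n) ^ p)"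
      proof (rule sum_mono)
        fix k assume "k \<in> {..p}"
        then show "mhs1 n k * mhs_star1 (Suc n) (p - k) \<le> harm (Suc n) ^ p"
          using mhs1_mult_mhs_star1_le[of n "Suc n" k "p - k"] by simp
      qed
      moreover have "sqrt (real n) \<le> real (Suc n)"
        by (rule real_le_lsqrt) (simp_all add: power2_eq_square algebra_simps)
      ultimately show ?case
        using elim unfolding Suc tail_coeff_Suc_eq times_divide_eq_right
        by (intro frac_le) (auto intro!: sum_nonneg mult_nonneg_nonneg zero_le_power harm_nonneg)
    qed
    show "(\<lambda>n. real (Suc p) * (harm (Suc n) ^ p / sqrt (real n))) \<longlonglongrightarrow> 0"
      using tendsto_mult_right_zero[OF harm_power_sqrt_tendsto_0[of p]] .
  qed simp
next
  case 0
  have "tail_coeff 0 = (\<lambda>_. 0)" by auto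
  then show ?thesis by (simp add: 0)
qed

subsection \<open>Partial sums of the expansion\<close>

text \<open>By parity this is \<open>P_n\<close> at 1 - 2 x, so it is 1 at x = 0 and alternates in
  sign with n at x = 1.\<close>

definition alt_legendre :: "nat \<Rightarrow> real \<Rightarrow> real" where
  "alt_legendre n x = (-1) ^ n * poly (legendre_poly n) (2 * x - 1)"

definition alt_legendre' :: "nat \<Rightarrow> real \<Rightarrow> real" where
  "alt_legendre' n x = (-1) ^ n * (2 * poly (pderiv (legendre_poly n)) (2 * x - 1))"

lemma DERIV_alt_legendre [derivative_intros]:
  assumes "(g has_real_derivative g') (at x within S)"
  shows "((\<lambda>x. alt_legendre n (g x)) has_real_derivative alt_legendre' n (g x) * g') (at x within S)"
proof -
  have "((\<lambda>x. poly (legendre_poly n) (2 * g x - 1)) has_real_derivative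
      poly (pderiv (legendre_poly n)) (2 * g x - 1) * (2 * g')) (at x within S)"
    by (rule DERIV_chain2[OF poly_DERIV]) (auto intro!: derivative_eq_intros assms)
  from DERIV_cmult[OF this, of "(-1) ^ n"] show ?thesis
    by (simp add: alt_legendre_def alt_legendre'_def mult_ac)
qed

lemma alt_legendre_0 [simp]: "alt_legendre 0 x = 1" "alt_legendre' 0 x = 0"
  by (simp_all add: alt_legendre_def alt_legendre'_def)

lemma alt_legendre_1 [simp]: "alt_legendre n 1 = (-1) ^ n"
  by (simp add: alt_legendre_def)

lemma abs_alt_legendre_le_1: "0 \<le> x \<Longrightarrow> x \<le> 1 \<Longrightarrow> \<bar>alt_legendre n x\<bar> \<le> 1"
  using abs_legendre_le_1[of "2 * x - 1" n] by (simp add: alt_legendre_def abs_mult)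

lemma alt_legendre'_add:
  "x * (alt_legendre' (Suc n) x + alt_legendre' n x) = real (Suc n) * (alt_legendre (Suc n) x - alt_legendre n x)"
proof -
  have "x * (alt_legendre' (Suc n) x + alt_legendre' n x) = - ((-1) ^ n *
      ((1 + (2 * x - 1)) * (poly (pderiv (legendre_poly (Suc n))) (2 * x - 1) - poly (pderiv (legendre_poly n)) (2 * x - 1))))"
    by (simp add: alt_legendre'_def algebra_simps)
  also have "\<dots> = real (Suc n) * (alt_legendre (Suc n) x - alt_legendre n x)"
    unfolding poly_pderiv_legendre_diff by (simp add: alt_legendre_def algebra_simps)
  finally show ?thesis .
qed

lemma abs_sum_alt_legendre_le:
  assumes "0 < x" "x \<le> 1"
  shows "\<bar>\<Sum>n\<le>N. real (2 * n + 1) * alt_legendre n x\<bar> \<le> real (Suc N) / x"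
proof -
  have "(2 * x) * (\<Sum>n\<le>N. real (2 * n + 1) * alt_legendre n x) = real (Suc N) * (alt_legendre N x - alt_legendre (Suc N) x)"
    using legendre_christoffel_darboux_minus_1[of "2 * x - 1" N] by (simp add: alt_legendre_def algebra_simps)
  from arg_cong[OF this, of abs] have "(2 * x) * \<bar>\<Sum>n\<le>N. real (2 * n + 1) * alt_legendre n x\<bar> = real (Suc N) * \<bar>alt_legendre N x - alt_legendre (Suc N) x\<bar>"
    unfolding abs_mult using assms by (simp del: of_nat_Suc)
  also have "\<dots> \<le> real (Suc N) * 2"
    using abs_alt_legendre_le_1[of x N] abs_alt_legendre_le_1[of x "Suc N"] assms
    by (intro mult_left_mono) auto
  finally show ?thesis using assms by (simp add: field_simps)
qed

text \<open>An antiderivative of \<open>alt_legendre n\<close> from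
  \<open>poly_pderiv_legendre_diff2\<close>. The alternating sign reverses the order of the
  difference, and the factor 2 undoes the chain rule for 2 x - 1. Its denominator supplies the gain
  of order 1/n.\<close>

definition alt_legendre_int :: "nat \<Rightarrow> real \<Rightarrow> real" where
  "alt_legendre_int n x = (alt_legendre (n - 1) x - alt_legendre (Suc n) x) / (2 * real (2 * n + 1))"

lemma DERIV_alt_legendre_int:
  assumes "n > 0"
  shows "(alt_legendre_int n has_real_derivative alt_legendre n x) (at x)"
proof -
  obtain k where n: "n = Suc k" using assms by (cases n) auto
  have "(alt_legendre_int n has_real_derivative (alt_legendre' k x - alt_legendre' (Suc n) x) / (2 * real (2 * n + 1))) (at x)"
    unfolding alt_legendre_int_def[abs_def] n by (auto intro!: derivative_eq_intros)
  also have "alt_legendre' k x - alt_legendre' (Suc n) x = 2 * real (2 * n + 1) * alt_legendre n x"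
    using poly_pderiv_legendre_diff2[of k "2 * x - 1"]
    by (simp add: alt_legendre_def alt_legendre'_def n algebra_simps)
  finally show ?thesis by simp
qed

lemma abs_alt_legendre_int_le:
  assumes "0 \<le> x" "x \<le> 1"
  shows "real (Suc n) * \<bar>alt_legendre_int n x\<bar> \<le> 1"
proof -
  have "\<bar>alt_legendre (n - 1) x - alt_legendre (Suc n) x\<bar> \<le> 2"
    using abs_alt_legendre_le_1[of x "n - 1"] abs_alt_legendre_le_1[of x "Suc n"] assms by simp
  then have "real (Suc n) * \<bar>alt_legendre (n - 1) x - alt_legendre (Suc n) x\<bar> \<le> real (2 * n + 1) * 2"
    by (intro mult_mono) auto
  then show ?thesis by (simp add: alt_legendre_int_def field_simps)
qed

definition log_sum :: "nat \<Rightarrow> nat \<Rightarrow> real \<Rightarrow> real" where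
  "log_sum m N x = (\<Sum>n\<le>N. real (2 * n + 1) * log_coeff m n * alt_legendre n x)"

lemma log_sum_0 [simp]: "log_sum 0 N x = 1"
  by (induction N) (simp_all add: log_sum_def)

text \<open>By \<open>tail_coeff_add\<close> each summand at x = 1 is an alternating difference of
  neighbouring tails. The result tends to 0, the value of the logarithm power there.\<close>

lemma log_sum_1: "log_sum (Suc m) N 1 = (-1) ^ N * tail_coeff (Suc m) N"
proof (induction N)
  case (Suc N)
  have "log_sum (Suc m) (Suc N) 1 = (-1) ^ N * (tail_coeff (Suc m) N - real (2 * N + 3) * log_coeff (Suc m) (Suc N))"
    using Suc by (simp add: log_sum_def algebra_simps)
  also have "tail_coeff (Suc m) N - real (2 * N + 3) * log_coeff (Suc m) (Suc N) = - tail_coeff (Suc m) (Suc N)"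
    using tail_coeff_add[of "Suc m" N] by linarith
  finally show ?case by simp
qed (simp add: log_sum_def tail_coeff_at_0)

definition log_sum' :: "nat \<Rightarrow> nat \<Rightarrow> real \<Rightarrow> real" where
  "log_sum' m N x = (\<Sum>n\<le>N. real (2 * n + 1) * log_coeff m n * alt_legendre' n x)"

lemma DERIV_log_sum: "(log_sum m N has_real_derivative log_sum' m N x) (at x)"
  unfolding log_sum_def[abs_def] log_sum'_def
  by (auto intro!: derivative_eq_intros simp: mult_ac)

text \<open>The coefficientwise form of \<open>x f' = - s f\<close> for \<open>f x = x powr (-s)\<close>, which the partial sums
  satisfy up to a boundary term.\<close>
lemma log_sum'_eq:
  "x * log_sum' (Suc m) N x =
     - log_sum m N x + tail_coeff (Suc m) N * (real (Suc N) * alt_legendre N x + x * alt_legendre' N x)"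
proof (induction N)
  case 0
  then show ?case by (simp add: log_sum_def log_sum'_def tail_coeff_at_0)
next
  case (Suc N)
  define a b where "a = tail_coeff (Suc m) N" and "b = tail_coeff (Suc m) (Suc N)"
  define q r where "q = alt_legendre N x" and "r = alt_legendre (Suc N) x"
  define q' r' where "q' = alt_legendre' N x" and "r' = alt_legendre' (Suc N) x"
  have e1: "real (2 * N + 3) * log_coeff (Suc m) (Suc N) = b + a"
    unfolding a_def b_def by (rule tail_coeff_add[symmetric])
  have e2: "real (2 * N + 3) * log_coeff m (Suc N) = real (Suc (Suc N)) * b - real (Suc N) * a"
    unfolding a_def b_def by (rule tail_coeff_diff[symmetric])
  have e3: "x * r' = real (Suc N) * (r - q) - x * q'"
    using alt_legendre'_add[of x N] by (simp add: q_def r_def q'_def r'_def algebra_simps)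
  have "x * log_sum' (Suc m) (Suc N) x = x * log_sum' (Suc m) N x + (b + a) * (x * r')"
    unfolding e1[symmetric] by (simp add: log_sum'_def r'_def distrib_left mult_ac del: of_nat_Suc of_nat_add of_nat_mult)
  moreover have "log_sum m (Suc N) x = log_sum m N x + (real (Suc (Suc N)) * b - real (Suc N) * a) * r"
    unfolding e2[symmetric] by (simp add: log_sum_def r_def del: of_nat_Suc of_nat_add of_nat_mult)
  moreover have "x * log_sum' (Suc m) N x = - log_sum m N x + a * (real (Suc N) * q + x * q')"
    using Suc by (simp add: a_def q_def q'_def)
  \<comment> \<open>Only the multiple of \<open>a\<close> is rewritten by \<open>e3\<close>,
    cancelling the old boundary term; the term \<open>b * (x * r')\<close> already belongs to the
    new one.\<close>
  moreover have "a * (x * r') = a * (real (Suc N) * (r - q) - x * q')" by (simp only: e3)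
  ultimately show ?case
    unfolding b_def[symmetric] r_def[symmetric] r'_def[symmetric] by (simp add: algebra_simps)
qed

section \<open>Uniform error estimate against the powers of the logarithm\<close>

definition log_power :: "nat \<Rightarrow> real \<Rightarrow> real" where
  "log_power m x = (- ln x) ^ m / fact m"

lemma DERIV_log_power_Suc:
  assumes "x > 0"
  shows "(log_power (Suc m) has_real_derivative - log_power m x / x) (at x)"
proof -
  have "((\<lambda>x. (- ln x) ^ Suc m) has_real_derivative real (Suc m) * (- ln x) ^ m * (- (1 / x))) (at x)"
    by (rule derivative_eq_intros assms refl)+ simp
  then have "(log_power (Suc m) has_real_derivative real (Suc m) * (- ln x) ^ m * (- (1 / x)) / fact (Suc m)) (at x)"
    unfolding log_power_def[abs_def] by (rule DERIV_cdivide)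
  then show ?thesis by (simp add: log_power_def fact_Suc mult.commute del: of_nat_Suc)
qed

text \<open>The derivative of the error contains the boundary term of \<open>log_sum'_eq\<close>, which is not small;
  subtracting an approximate antiderivative of it leaves a small derivative.\<close>
lemma log_sum_error:
  assumes x: "0 < x" and N: "N > 0" and y: "x \<le> y" "y \<le> 1"
    and IH: "\<And>y. x \<le> y \<Longrightarrow> y \<le> 1 \<Longrightarrow> \<bar>log_sum m N y - log_power m y\<bar> \<le> e"
  shows "\<bar>log_sum (Suc m) N y - log_power (Suc m) y\<bar> \<le>
    e / x + (4 + 1 / x + 1 / x\<^sup>2) * tail_coeff (Suc m) N"
proof -
  define a where "a = tail_coeff (Suc m) N"
  have a: "a \<ge> 0" by (simp add: a_def tail_coeff_nonneg)
  define Q where "Q = (\<lambda>y. real (Suc N) * alt_legendre_int N y)"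
  have Q: "\<bar>Q y\<bar> \<le> 1" if "x \<le> y" "y \<le> 1" for y
    using abs_alt_legendre_int_le[of y N] that x by (simp add: Q_def abs_mult)
  \<comment> \<open>Divided by y, the boundary term is \<open>a\<close> times
    \<open>alt_legendre' N y + real (Suc N) * alt_legendre N y / y\<close>. The derivative of
    \<open>alt_legendre N y + Q y / y\<close> equals that up to \<open>- Q y / y\<^sup>2\<close>,
    which stays bounded because \<open>Q\<close> does.\<close>
  define E where "E = (\<lambda>y. log_sum (Suc m) N y - log_power (Suc m) y - a * (alt_legendre N y + Q y / y))"
  have E': "(E has_real_derivative - (log_sum m N y - log_power m y) / y + a * Q y / y\<^sup>2) (at y)"
    if "y > 0" for y
  proof -
    have "(E has_real_derivative log_sum' (Suc m) N y - (- log_power m y / y) -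
        a * (alt_legendre' N y + (real (Suc N) * alt_legendre N y * y - Q y) / (y * y))) (at y)"
      unfolding E_def Q_def
      by (rule derivative_eq_intros DERIV_log_sum DERIV_log_power_Suc DERIV_alt_legendre_int N that refl
        | (use that in simp))+
    also have "log_sum' (Suc m) N y =
        (- log_sum m N y + a * (real (Suc N) * alt_legendre N y + y * alt_legendre' N y)) / y"
      using log_sum'_eq[of y m N] that by (simp add: a_def field_simps)
    also have "(- log_sum m N y + a * (real (Suc N) * alt_legendre N y + y * alt_legendre' N y)) / y
        - (- log_power m y / y) - a * (alt_legendre' N y + (real (Suc N) * alt_legendre N y * y - Q y) / (y * y)) =
       - (log_sum m N y - log_power m y) / y + a * Q y / y\<^sup>2"
      using that by (simp add: divide_simps power2_eq_square del: of_nat_Suc) (simp add: algebra_simps)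
    finally show ?thesis .
  qed
  have E'_le: "norm (- (log_sum m N z - log_power m z) / z + a * Q z / z\<^sup>2) \<le> e / x + a / x\<^sup>2"
    if "z \<in> {x..1}" for z
  proof -
    have "e \<ge> 0" using IH[of z] that by auto
    have z: "z > 0" "x \<le> z" "z \<le> 1" using that x by auto
    have "\<bar>- (log_sum m N z - log_power m z) / z\<bar> \<le> e / x"
      unfolding abs_divide abs_minus using IH[of z] z x \<open>e \<ge> 0\<close> by (intro frac_le) auto
    moreover have "\<bar>a * Q z / z\<^sup>2\<bar> \<le> a / x\<^sup>2"
      unfolding abs_divide abs_mult using Q[of z] z x a
      by (intro frac_le) (auto intro: mult_left_le power_mono)
    ultimately show ?thesis unfolding real_norm_def by linarith
  qed
  have "norm (E 1 - E y) \<le> (e / x + a / x\<^sup>2) * norm (1 - y)"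
    by (rule field_differentiable_bound[of "{x..1}", OF _ DERIV_subset[OF E'] E'_le]) (use x y in auto)
  also have "\<dots> \<le> (e / x + a / x\<^sup>2) * 1"
  proof (rule mult_left_mono)
    show "0 \<le> e / x + a / x\<^sup>2" using E'_le[of y] y norm_ge_zero order_trans by fastforce
  qed (use x y in auto)
  finally have "\<bar>E 1 - E y\<bar> \<le> e / x + a / x\<^sup>2" by simp
  \<comment> \<open>At 1 the subtracted \<open>a * alt_legendre N 1\<close> is exactly
    \<open>log_sum (Suc m) N 1\<close>, and \<open>log_power (Suc m) 1\<close> is 0.\<close>
  moreover have "E 1 = - (a * Q 1)"
    by (simp add: E_def log_sum_1 log_power_def a_def algebra_simps)
  moreover have "\<bar>a * Q 1\<bar> \<le> a"
    unfolding abs_mult using a Q[of 1] y by (simp add: mult_left_le)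
  moreover have "\<bar>a * (alt_legendre N y + Q y / y)\<bar> \<le> a * (1 + 1 / x)"
  proof -
    have "\<bar>Q y / y\<bar> \<le> 1 / x" unfolding abs_divide using x y Q[of y] by (intro frac_le) auto
    then have "\<bar>alt_legendre N y + Q y / y\<bar> \<le> 1 + 1 / x"
      using abs_alt_legendre_le_1[of y N] x y by linarith
    then show ?thesis using a by (simp add: abs_mult mult_left_mono)
  qed
  moreover have "log_sum (Suc m) N y - log_power (Suc m) y = E y + a * (alt_legendre N y + Q y / y)"
    by (simp add: E_def)
  ultimately have "\<bar>log_sum (Suc m) N y - log_power (Suc m) y\<bar> \<le> e / x + a / x\<^sup>2 + a + a * (1 + 1 / x)"
    by linarith
  also have "\<dots> \<le> e / x + (4 + 1 / x + 1 / x\<^sup>2) * a"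
    using a by (simp add: algebra_simps)
  finally show ?thesis by (simp add: a_def)
qed

text \<open>The induction needs uniformity: the error of order m + 1 at y integrates the error of
  order m over the whole interval from y to 1.\<close>

lemma log_sum_uniform:
  assumes x: "0 < x"
  shows "\<exists>e. e \<longlonglongrightarrow> 0 \<and>
    (\<forall>N>0. \<forall>y. x \<le> y \<longrightarrow> y \<le> 1 \<longrightarrow> \<bar>log_sum m N y - log_power m y\<bar> \<le> e N)"
proof (induction m)
  case 0
  show ?case by (rule exI[of _ "\<lambda>_. 0"]) (simp add: log_power_def)
next
  case (Suc m)
  then obtain e where e: "e \<longlonglongrightarrow> 0"
    "\<And>N y. N > 0 \<Longrightarrow> x \<le> y \<Longrightarrow> y \<le> 1 \<Longrightarrow> \<bar>log_sum m N y - log_power m y\<bar> \<le> e N"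
    by blast
  show ?case
  proof (intro exI conjI allI impI)
    have "(\<lambda>N. e N / x + (4 + 1 / x + 1 / x\<^sup>2) * tail_coeff (Suc m) N)
        \<longlonglongrightarrow> 0 / x + (4 + 1 / x + 1 / x\<^sup>2) * 0"
      by (intro tendsto_intros e tail_coeff_tendsto_0) (use x in auto)
    then show "(\<lambda>N. e N / x + (4 + 1 / x + 1 / x\<^sup>2) * tail_coeff (Suc m) N) \<longlonglongrightarrow> 0" by simp
  next
    fix N :: nat and y assume "N > 0" "x \<le> y" "y \<le> 1"
    then show "\<bar>log_sum (Suc m) N y - log_power (Suc m) y\<bar> \<le>
        e N / x + (4 + 1 / x + 1 / x\<^sup>2) * tail_coeff (Suc m) N"
      by (intro log_sum_error x e)
  qed
qed

lemma log_sum_tendsto: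
  assumes "0 < x" "x \<le> 1"
  shows "(\<lambda>N. log_sum m N x) \<longlonglongrightarrow> log_power m x"
proof -
  obtain e where e: "e \<longlonglongrightarrow> 0" "\<And>N. N > 0 \<Longrightarrow> \<bar>log_sum m N x - log_power m x\<bar> \<le> e N"
    using log_sum_uniform[of x m] assms by blast
  have "(\<lambda>N. log_sum m N x - log_power m x) \<longlonglongrightarrow> 0"
    by (rule Lim_null_comparison[OF _ e(1)])
       (use eventually_gt_at_top[of 0] in \<open>eventually_elim, simp add: e(2)\<close>)
  then show ?thesis by (rule LIM_zero_cancel)
qed

subsection \<open>Convergence of the series for each \<open>k\<close>\<close>

text \<open>Summation by parts against the partial sums of \<open>(2 n + 1) (-1)\<^sup>n P\<^sub>n\<close>, which grow linearly.\<close>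
lemma summable_alt_legendre:
  fixes g :: "nat \<Rightarrow> real"
  assumes x: "0 < x" "x \<le> 1"
    and g: "\<And>i. g i \<ge> 0" "\<And>i. g i \<le> g (Suc i)" "\<And>i. g i \<le> harm (i + 2) ^ p"
  shows "summable (\<lambda>i. g i / (real (Suc i) * real (i + 2)) *
    (real (2 * Suc i + 1) * alt_legendre (Suc i) x))"
proof -
  define t where "t = (\<lambda>n. real (2 * n + 1) * alt_legendre n x)"
  define T where "T = (\<lambda>n. \<Sum>j\<le>n. t j)"
  define e where "e = (\<lambda>i. g i / (real (Suc i) * real (i + 2)))"
  have T: "\<bar>T n\<bar> \<le> real (Suc n) / x" for n
    unfolding T_def t_def by (rule abs_sum_alt_legendre_le[OF x])
  have g_sqrt: "(\<lambda>i. g i / sqrt (real (Suc i))) \<longlonglongrightarrow> 0"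
  proof (rule tendsto_sandwich)
    show "eventually (\<lambda>i. 0 \<le> g i / sqrt (real (Suc i))) sequentially" using g by simp
    show "eventually (\<lambda>i. g i / sqrt (real (Suc i)) \<le> harm (Suc (Suc i)) ^ p / sqrt (real (Suc i))) sequentially"
      using g(3) by (intro always_eventually allI divide_right_mono) auto
    show "(\<lambda>i. harm (Suc (Suc i)) ^ p / sqrt (real (Suc i))) \<longlonglongrightarrow> (0 :: real)"
      using LIMSEQ_Suc[OF harm_power_sqrt_tendsto_0] .
  qed simp
  have sqrt_le: "sqrt (real (Suc i)) \<le> real (i + 2)" for i
    by (rule real_le_lsqrt) (simp_all add: power2_eq_square algebra_simps)
  have g_lim: "(\<lambda>i. g i / real (i + 2)) \<longlonglongrightarrow> 0"
  proof (rule tendsto_sandwich[OF _ _ tendsto_const g_sqrt])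
    show "eventually (\<lambda>i. 0 \<le> g i / real (i + 2)) sequentially" using g by simp
    show "eventually (\<lambda>i. g i / real (i + 2) \<le> g i / sqrt (real (Suc i))) sequentially"
      using g(1) sqrt_le by (intro always_eventually allI divide_left_mono) auto
  qed
  have g_sum: "summable (\<lambda>i. g i / (real (Suc i))\<^sup>2)"
  proof (rule summable_comparison_test_ev)
    have "eventually (\<lambda>i. g i / sqrt (real (Suc i)) < 1) sequentially"
      using order_tendstoD(2)[OF g_sqrt, of 1] by simp
    then show "eventually (\<lambda>i. norm (g i / (real (Suc i))\<^sup>2) \<le> real (Suc i) powr (- (3 / 2))) sequentially"
    proof eventually_elim
      case (elim i)
      then have "g i / (real (Suc i))\<^sup>2 \<le> sqrt (real (Suc i)) / (real (Suc i))\<^sup>2"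
        by (intro divide_right_mono) (auto simp: field_simps)
      also have "\<dots> = real (Suc i) powr (1 / 2) / real (Suc i) powr 2"
        by (simp add: powr_half_sqrt del: of_nat_Suc)
      also have "\<dots> = real (Suc i) powr (- (3 / 2))"
        by (subst powr_diff[symmetric]) simp
      finally show ?case using g(1) by simp
    qed
    show "summable (\<lambda>i. real (Suc i) powr (- (3 / 2)))"
      by (subst summable_Suc_iff[of "\<lambda>i. real i powr (- (3 / 2))"]) (simp add: summable_real_powr_iff)
  qed
  \<comment> \<open>Since \<open>t (Suc i)\<close> is \<open>T (Suc i) - T i\<close>, the term
    \<open>e i * t (Suc i)\<close> is this telescoping difference minus
    \<open>(e (Suc i) - e i) * T (Suc i)\<close>.\<close>
  have "summable (\<lambda>i. e (Suc i) * T (Suc i) - e i * T i)"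
  proof (rule telescope_summable)
    have "norm (e i * T i) \<le> g i / real (i + 2) * (1 / x)" for i
    proof -
      have "norm (e i * T i) \<le> e i * (real (Suc i) / x)"
        using mult_left_mono[OF T[of i], of "e i"] g(1)[of i] by (simp add: abs_mult e_def)
      also have "\<dots> = g i / real (i + 2) * (1 / x)" by (simp add: e_def del: of_nat_Suc of_nat_add)
      finally show ?thesis .
    qed
    then show "(\<lambda>i. e i * T i) \<longlonglongrightarrow> 0"
      by (intro Lim_null_comparison[OF _ tendsto_mult_left_zero[OF g_lim, of "1 / x"]] always_eventually allI)
  qed
  moreover have "summable (\<lambda>i. (e (Suc i) - e i) * T (Suc i))"
  proof (rule summable_comparison_test_ev)
    have "norm ((e (Suc i) - e i) * T (Suc i)) \<le>
        ((g (Suc i) / real (Suc i + 2) - g i / real (i + 2)) + 3 * (g i / (real (Suc i))\<^sup>2)) * (1 / x)" for i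
    proof -
      define a where "a = real i"
      have a: "a \<ge> 0" by (simp add: a_def)
      \<comment> \<open>The common factor a + 2 is pulled out to absorb the linear growth of
        \<open>T (Suc i)\<close>, which is at most (a + 2) / x in absolute value.\<close>
      have "e (Suc i) - e i = (g (Suc i) / (a + 3) - g i / (a + 1)) / (a + 2)"
        by (simp add: e_def a_def diff_divide_distrib) (simp add: add.commute mult.commute)
      then have "norm ((e (Suc i) - e i) * T (Suc i)) = \<bar>g (Suc i) / (a + 3) - g i / (a + 1)\<bar> * (\<bar>T (Suc i)\<bar> / (a + 2))"
        using a by (simp add: abs_mult)
      also have "\<dots> \<le> \<bar>g (Suc i) / (a + 3) - g i / (a + 1)\<bar> * (1 / x)"
        using T[of "Suc i"] a x by (intro mult_left_mono) (auto simp: field_simps a_def)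
      also have "\<bar>g (Suc i) / (a + 3) - g i / (a + 1)\<bar> \<le>
          (g (Suc i) / (a + 3) - g i / (a + 2)) + 3 * (g i / (a + 1)\<^sup>2)"
      proof -
        \<comment> \<open>As \<open>g\<close> grows, the difference has no fixed sign. The
          nonnegative increment of \<open>g\<close> is separated and turned back into a telescoping
          difference; the corrections are at most 1 and 2 times
          \<open>g i / (a + 1)\<^sup>2\<close>, whence the constant 3.\<close>
        have "g (Suc i) / (a + 3) - g i / (a + 1) = (g (Suc i) - g i) / (a + 3) - g i * (2 / ((a + 1) * (a + 3)))"
          using a by (simp add: divide_simps) (simp add: algebra_simps)
        then have "\<bar>g (Suc i) / (a + 3) - g i / (a + 1)\<bar> \<le> (g (Suc i) - g i) / (a + 3) + g i * (2 / ((a + 1) * (a + 3)))"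
          using a g(1)[of i] g(2)[of i] by (simp add: abs_if)
        also have "\<dots> = (g (Suc i) / (a + 3) - g i / (a + 2)) + g i * (1 / ((a + 2) * (a + 3)) + 2 / ((a + 1) * (a + 3)))"
          using a by (simp add: divide_simps) (simp add: algebra_simps)
        also have "\<dots> \<le> (g (Suc i) / (a + 3) - g i / (a + 2)) + g i * (1 / (a + 1)\<^sup>2 + 2 / (a + 1)\<^sup>2)"
          unfolding power2_eq_square using a g(1)[of i]
          by (intro add_left_mono mult_left_mono add_mono divide_left_mono mult_mono mult_pos_pos) auto
        also have "\<dots> = (g (Suc i) / (a + 3) - g i / (a + 2)) + 3 * (g i / (a + 1)\<^sup>2)"
          by (simp add: add_divide_distrib[symmetric])
        finally show ?thesis .
      qed
      finally show ?thesis using x by (simp add: a_def add.commute mult_right_mono divide_right_mono)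
    qed
    then show "eventually (\<lambda>i. norm ((e (Suc i) - e i) * T (Suc i)) \<le>
        ((g (Suc i) / real (Suc i + 2) - g i / real (i + 2)) + 3 * (g i / (real (Suc i))\<^sup>2)) * (1 / x)) sequentially"
      by (intro always_eventually allI)
    show "summable (\<lambda>i. ((g (Suc i) / real (Suc i + 2) - g i / real (i + 2)) + 3 * (g i / (real (Suc i))\<^sup>2)) * (1 / x))"
      by (intro summable_mult2 summable_add summable_mult g_sum telescope_summable[OF g_lim])
  qed
  ultimately have "summable (\<lambda>i. (e (Suc i) * T (Suc i) - e i * T i) - (e (Suc i) - e i) * T (Suc i))"
    by (rule summable_diff)
  also have "(\<lambda>i. (e (Suc i) * T (Suc i) - e i * T i) - (e (Suc i) - e i) * T (Suc i)) = (\<lambda>i. e i * t (Suc i))"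
    by (simp add: fun_eq_iff T_def algebra_simps)
  finally show ?thesis by (simp add: e_def t_def)
qed

lemma log_legendre_term_Suc:
  "log_legendre_term m k x (Suc i) = mhs1 i (k - 1) * mhs_star1 (i + 2) (m - k) / (real (Suc i) * real (i + 2)) *
     (real (2 * Suc i + 1) * alt_legendre (Suc i) x)"
proof -
  have "log_legendre_term m k x (Suc i) =
     (-1) ^ Suc i * (real (2 * Suc i + 1) * mhs1 (Suc i - 1) (k - 1) * mhs_star1 (Suc i + 1) (m - k))
       / (real (Suc i) * real (Suc i + 1)) * poly (legendre_poly (Suc i)) (2 * x - 1)"
    by (simp only: log_legendre_term_def mhs1_def mhs_star1_def)
  moreover have "Suc i - 1 = i" "Suc i + 1 = i + 2" by simp_all
  ultimately show ?thesis
    by (simp only: alt_legendre_def) (simp del: of_nat_Suc of_nat_add of_nat_mult power_Suc)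
qed

text \<open>For fixed k the coefficients are nonnegative, increasing in the index apart from the
  denominator, and bounded by a power of a harmonic number.\<close>

lemma summable_log_legendre_term:
  assumes "0 < x" "x \<le> 1"
  shows "summable (\<lambda>i. log_legendre_term m k x (Suc i))"
  unfolding log_legendre_term_Suc
proof (rule summable_alt_legendre[OF assms])
  fix i
  show "0 \<le> mhs1 i (k - 1) * mhs_star1 (i + 2) (m - k)"
    by (intro mult_nonneg_nonneg mhs1_nonneg mhs_star1_nonneg)
  show "mhs1 i (k - 1) * mhs_star1 (i + 2) (m - k) \<le> mhs1 (Suc i) (k - 1) * mhs_star1 (Suc i + 2) (m - k)"
    using mhs1_le_Suc[of i "k - 1"] mhs_star1_le_Suc[of "i + 2" "m - k"]
    by (intro mult_mono mhs1_nonneg mhs_star1_nonneg) auto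
  show "mhs1 i (k - 1) * mhs_star1 (i + 2) (m - k) \<le> harm (i + 2) ^ ((k - 1) + (m - k))"
    by (intro mhs1_mult_mhs_star1_le) simp
qed

lemma sum_log_legendre_term:
  assumes "m \<ge> 1"
  shows "(\<Sum>k=1..m. log_legendre_term m k x (Suc i)) =
    real (2 * Suc i + 1) * log_coeff m (Suc i) * alt_legendre (Suc i) x"
proof -
  obtain p where m: "m = Suc p" using assms by (cases m) auto
  have "(\<Sum>k=1..m. log_legendre_term m k x (Suc i)) =
      (\<Sum>k=1..m. mhs1 i (k - 1) * mhs_star1 (i + 2) (m - k)) / (real (Suc i) * real (i + 2)) *
        (real (2 * Suc i + 1) * alt_legendre (Suc i) x)"
    unfolding log_legendre_term_Suc by (simp only: sum_divide_distrib sum_distrib_right)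
  also have "(\<Sum>k=1..m. mhs1 i (k - 1) * mhs_star1 (i + 2) (m - k)) = (\<Sum>k\<le>p. mhs1 i k * mhs_star1 (i + 2) (p - k))"
    unfolding m One_nat_def sum.shift_bounds_cl_Suc_ivl atLeast0AtMost by simp
  finally show ?thesis by (simp add: m log_coeff_Suc_Suc_eq del: of_nat_Suc of_nat_add of_nat_mult)
qed

lemma log_power_legendre_expansion:
  assumes "m \<ge> 1" "0 < x" "x \<le> 1"
  shows "log_power m x = 1 + (\<Sum>k=1..m. \<Sum>i. log_legendre_term m k x (Suc i))"
proof -
  define h where "h = (\<lambda>n. real (2 * n + 1) * log_coeff m n * alt_legendre n x)"
  have "(\<lambda>N. \<Sum>n<Suc N. h n) \<longlonglongrightarrow> log_power m x"
    using log_sum_tendsto[OF assms(2,3), of m] by (simp add: log_sum_def h_def lessThan_Suc_atMost)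
  then have "h sums log_power m x"
    unfolding sums_def by (rule LIMSEQ_imp_Suc)
  then have "(\<lambda>i. h (Suc i)) sums (log_power m x - h 0)"
    by (simp add: sums_Suc_iff)
  moreover have "h (Suc i) = (\<Sum>k=1..m. log_legendre_term m k x (Suc i))" for i
    unfolding h_def by (rule sum_log_legendre_term[OF assms(1), symmetric])
  ultimately have "(\<Sum>i. \<Sum>k=1..m. log_legendre_term m k x (Suc i)) = log_power m x - h 0"
    by (simp add: sums_iff)
  \<comment> \<open>This exchange is where summability for each individual k enters.\<close>
  moreover have "(\<Sum>i. \<Sum>k=1..m. log_legendre_term m k x (Suc i)) = (\<Sum>k=1..m. \<Sum>i. log_legendre_term m k x (Suc i))"
    by (intro suminf_sum summable_log_legendre_term assms)
  ultimately show ?thesis by (simp add: h_def)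
qed

subsection \<open>Higher derivatives of powers of the logarithm\<close>

definition ln_deriv_coeff :: "nat \<Rightarrow> nat \<Rightarrow> real" where
  "ln_deriv_coeff m k = (-1) ^ k * fact k * real (m choose k)"

text \<open>Up to sign the coefficient is the falling factorial m (m - 1) ... (m - k + 1), and m - k
  is its next factor. That factor is also the exponent brought down when the logarithm power is
  differentiated.\<close>

lemma ln_deriv_coeff_Suc:
  "ln_deriv_coeff (Suc p) k * real (Suc p - k) = - ln_deriv_coeff (Suc p) (Suc k)"
proof -
  have "(Suc p - k) * (Suc p choose k) = Suc k * (Suc p choose Suc k)"
    using binomial_absorb_comp[of "Suc p" k] Suc_times_binomial[of k p] by simp
  then have "real (Suc p - k) * real (Suc p choose k) = real (Suc k) * real (Suc p choose Suc k)"
    by (metis of_nat_mult)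
  then have "(-1) ^ k * fact k * (real (Suc p - k) * real (Suc p choose k)) =
      (-1) ^ k * fact k * (real (Suc k) * real (Suc p choose Suc k))"
    by (simp only:)
  then show ?thesis
    unfolding ln_deriv_coeff_def fact_Suc power_Suc by (simp only: mult_ac mult_minus_left mult_1_left of_nat_fact)
qed

definition ln_deriv_sum :: "nat \<Rightarrow> nat \<Rightarrow> real \<Rightarrow> real" where
  "ln_deriv_sum p N x = (\<Sum>j\<le>p. ln_deriv_coeff (Suc p) (Suc j) * mhs1 N j * ln x ^ (p - j))"

text \<open>One expression in two roles: it is -x times the derivative of
  \<open>ln_deriv_sum p N\<close>, and also N + 1 times the increment of \<open>ln_deriv_sum\<close>
  from N to N + 1. This coincidence closes the induction on the order.\<close>

definition ln_deriv_rest :: "nat \<Rightarrow> nat \<Rightarrow> real \<Rightarrow> real" where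
  "ln_deriv_rest p N x = (\<Sum>j<p. ln_deriv_coeff (Suc p) (Suc (Suc j)) * mhs1 N j * ln x ^ (p - Suc j))"

lemma ln_deriv_sum_Suc:
  "real (Suc N) * ln_deriv_sum p (Suc N) x = real (Suc N) * ln_deriv_sum p N x + ln_deriv_rest p N x"
proof -
  have "real (Suc N) * mhs1 (Suc N) (Suc j) = real (Suc N) * mhs1 N (Suc j) + mhs1 N j" for j
    by (simp add: mhs1_Suc_Suc distrib_left del: of_nat_Suc)
  then have "real (Suc N) * (c * mhs1 (Suc N) (Suc j) * l) = real (Suc N) * (c * mhs1 N (Suc j) * l) + c * mhs1 N j * l"
    for c j l
    by (metis (no_types, opaque_lifting) distrib_left mult.assoc mult.commute)
  then show ?thesis
    unfolding ln_deriv_sum_def ln_deriv_rest_def sum.atMost_shift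
    by (simp add: distrib_left sum_distrib_left sum.distrib del: of_nat_Suc)
qed

lemma DERIV_ln_deriv_sum:
  assumes "x > 0"
  shows "(ln_deriv_sum p N has_real_derivative - ln_deriv_rest p N x / x) (at x)"
proof -
  have "(ln_deriv_sum p N has_real_derivative
      (\<Sum>j\<le>p. ln_deriv_coeff (Suc p) (Suc j) * mhs1 N j * (real (p - j) * ln x ^ (p - Suc j) * (1 / x)))) (at x)"
    unfolding ln_deriv_sum_def[abs_def]
  proof (rule DERIV_sum)
    fix j
    have "((\<lambda>x. ln x ^ (p - j)) has_real_derivative real (p - j) * ln x ^ (p - Suc j) * (1 / x)) (at x)"
      by (rule derivative_eq_intros assms refl)+ simp
    then show "((\<lambda>x. ln_deriv_coeff (Suc p) (Suc j) * mhs1 N j * ln x ^ (p - j)) has_real_derivative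
        ln_deriv_coeff (Suc p) (Suc j) * mhs1 N j * (real (p - j) * ln x ^ (p - Suc j) * (1 / x))) (at x)"
      by (rule DERIV_cmult)
  qed
  also have "(\<Sum>j\<le>p. ln_deriv_coeff (Suc p) (Suc j) * mhs1 N j * (real (p - j) * ln x ^ (p - Suc j) * (1 / x))) =
      (\<Sum>j\<le>p. ln_deriv_coeff (Suc p) (Suc j) * real (Suc p - Suc j) * (mhs1 N j * ln x ^ (p - Suc j) * (1 / x)))"
    by (simp add: mult_ac)
  \<comment> \<open>The top term j = p differentiates a constant; it drops out because its new
    coefficient contains \<open>Suc p choose Suc (Suc p)\<close>, which is 0.\<close>
  also have "\<dots> = - ln_deriv_rest p N x / x"
    unfolding ln_deriv_coeff_Suc ln_deriv_rest_def lessThan_Suc_atMost[symmetric] sum.lessThan_Suc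
    by (simp add: ln_deriv_coeff_def[of _ "Suc (Suc p)"] binomial_eq_0 sum_negf sum_divide_distrib mult.assoc)
  finally show ?thesis .
qed

lemma higher_deriv_ln_power:
  assumes "x > 0"
  shows "(deriv ^^ Suc N) (\<lambda>t. ln t ^ Suc p) x = (-1) ^ Suc N * fact N / x ^ Suc N * ln_deriv_sum p N x"
  using assms
proof (induction N arbitrary: x)
  case 0
  have "((\<lambda>t. ln t ^ Suc p) has_real_derivative real (Suc p) * ln x ^ p * (1 / x)) (at x)"
    by (rule derivative_eq_intros 0 refl)+ simp
  then have "deriv (\<lambda>t. ln t ^ Suc p) x = real (Suc p) * ln x ^ p * (1 / x)"
    by (rule DERIV_imp_deriv)
  \<comment> \<open>Only j = 0 contributes, since \<open>mhs1 0 j\<close> vanishes for positive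
    j.\<close>
  moreover have "ln_deriv_sum p 0 x = - (real (Suc p) * ln x ^ p)"
    unfolding ln_deriv_sum_def sum.atMost_shift by (simp add: ln_deriv_coeff_def algebra_simps)
  ultimately show ?case by simp
next
  case (Suc N)
  \<comment> \<open>The induction hypothesis is needed on a neighbourhood of x before it can be
    differentiated there.\<close>
  have "eventually (\<lambda>t. t \<in> {0<..}) (nhds x)"
    using Suc.prems by (intro eventually_nhds_in_open) auto
  then have "eventually (\<lambda>t. (deriv ^^ Suc N) (\<lambda>t. ln t ^ Suc p) t =
      (-1) ^ Suc N * fact N / t ^ Suc N * ln_deriv_sum p N t) (nhds x)"
    by eventually_elim (use Suc.IH in auto)
  then have "(deriv ^^ Suc (Suc N)) (\<lambda>t. ln t ^ Suc p) x =
      deriv (\<lambda>t. (-1) ^ Suc N * fact N / t ^ Suc N * ln_deriv_sum p N t) x"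
    unfolding funpow.simps(2)[of "Suc N"] o_apply by (intro deriv_cong_ev refl)
  also have "\<dots> = (-1) ^ Suc N * fact N * (- (real (Suc N) * ln_deriv_sum p N x + ln_deriv_rest p N x)) / x ^ Suc (Suc N)"
  proof (rule DERIV_imp_deriv)
    have "((\<lambda>t. (-1) ^ Suc N * fact N * (ln_deriv_sum p N t / t ^ Suc N)) has_real_derivative
        (-1) ^ Suc N * fact N * (((- ln_deriv_rest p N x / x) * x ^ Suc N
          - ln_deriv_sum p N x * (real (Suc N) * x ^ N)) / (x ^ Suc N * x ^ Suc N))) (at x)"
      by (intro DERIV_cmult DERIV_divide DERIV_ln_deriv_sum Suc.prems)
         (use Suc.prems DERIV_pow[of "Suc N" x UNIV] in simp_all)
    also have "((- ln_deriv_rest p N x / x) * x ^ Suc N - ln_deriv_sum p N x * (real (Suc N) * x ^ N))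
        / (x ^ Suc N * x ^ Suc N) = - (real (Suc N) * ln_deriv_sum p N x + ln_deriv_rest p N x) / x ^ Suc (Suc N)"
      using Suc.prems by (simp add: divide_simps del: of_nat_Suc) (simp add: algebra_simps)
    finally show "((\<lambda>t. (-1) ^ Suc N * fact N / t ^ Suc N * ln_deriv_sum p N t) has_real_derivative
       (-1) ^ Suc N * fact N * (- (real (Suc N) * ln_deriv_sum p N x + ln_deriv_rest p N x)) / x ^ Suc (Suc N)) (at x)"
      by simp
  qed
  also have "\<dots> = (-1) ^ Suc (Suc N) * fact (Suc N) / x ^ Suc (Suc N) * ln_deriv_sum p (Suc N) x"
    unfolding ln_deriv_sum_Suc[symmetric] by simp
  finally show ?case .
qed

(* The Legendre expansion is asserted for 0 < x \<le> 1 only: for x > 1 the values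
   P_n (2 x - 1) grow exponentially in n and the series diverges. *)

theorem theorem3p1:
  fixes m :: nat and x :: real
  assumes "m \<ge> 1" and "x > 0"
  shows "(x \<le> 1 \<longrightarrow>
            (\<forall>k\<in>{1..m}. summable (\<lambda>i. log_legendre_term m k x (Suc i))) \<and>
            ln x ^ m / (fact m * (-1) ^ m) =
              1 + (\<Sum>k=1..m. \<Sum>i. log_legendre_term m k x (Suc i)))
       \<and> (\<forall>n\<ge>1. (deriv ^^ n) (\<lambda>t. ln t ^ m) x =
            (-1) ^ n * fact (n - 1) / x ^ n *
              (\<Sum>k=1..m. (-1) ^ k * fact k * real (m choose k)
                 * mhs (n - 1) (ones (k - 1)) * ln x ^ (m - k)))"
proof (intro conjI impI ballI allI)
  show "summable (\<lambda>i. log_legendre_term m k x (Suc i))" if "x \<le> 1" for k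
    by (rule summable_log_legendre_term[OF assms(2) that])
  have "ln x ^ m / (fact m * (-1) ^ m) = log_power m x"
    by (simp add: log_power_def power_minus[of "ln x" m] divide_simps)
  then show "ln x ^ m / (fact m * (-1) ^ m) = 1 + (\<Sum>k=1..m. \<Sum>i. log_legendre_term m k x (Suc i))" if "x \<le> 1"
    using log_power_legendre_expansion[OF assms that] by simp
  fix n :: nat assume "n \<ge> 1"
  then obtain N where n: "n = Suc N" by (cases n) auto
  obtain p where m: "m = Suc p" using assms(1) by (cases m) auto
  have "(\<Sum>k=1..m. (-1) ^ k * fact k * real (m choose k) * mhs (n - 1) (ones (k - 1)) * ln x ^ (m - k)) =
      ln_deriv_sum p N x"
    unfolding mhs1_def[symmetric] ln_deriv_coeff_def[symmetric] ln_deriv_sum_def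
    unfolding m n One_nat_def sum.shift_bounds_cl_Suc_ivl atLeast0AtMost by simp
  then show "(deriv ^^ n) (\<lambda>t. ln t ^ m) x = (-1) ^ n * fact (n - 1) / x ^ n *
      (\<Sum>k=1..m. (-1) ^ k * fact k * real (m choose k) * mhs (n - 1) (ones (k - 1)) * ln x ^ (m - k))"
    using higher_deriv_ln_power[OF assms(2), of N p] unfolding m n by simp
qed

end
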